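(* Let $n \in \mathbb{N}$ and let $\mathbb{K}$ be a non-Archimedean valued field with valuation $|\cdot|$. Let $(a_j)_{j=1}^n, (b_j)_{j=1}^n \in \mathbb{K}^n$. Then $$\left|\sum_{j=1}^{n}a_jb_j\right|\leq \frac{1}{|n|}\max\left\{\left|\sum_{j=1}^{n}a_j\right|\left|\sum_{k=1}^{n}b_k\right|,\ \max_{1\leq j < k \leq n}|a_j-a_k||b_j-b_k|\right\}$$ and $$\left|\sum_{j=1}^{n}a_j\right|\left|\sum_{k=1}^{n}b_k\right|\leq \max\left\{|n|\left|\sum_{j=1}^{n}a_jb_j\right|,\ \max_{1\leq j < k \leq n}|a_j-a_k||b_j-b_k|\right\}.$$ In other words, $$\left|AM(a_jb_j)_{j=1}^n\right|\leq \max\left\{\left|AM(a_j)_{j=1}^n\right|\left|AM(b_j)_{j=1}^n\right|,\ \frac{1}{|n|^2}\max_{1\leq j < k \leq n}|a_j-a_k||b_j-b_k|\right\}.$$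
   Context: A non-Archimedean valued field is a field $\mathbb{K}$ with a map (non-Archimedean valuation) $|\cdot|:\mathbb{K}\to[0,\infty)$ such that (i) if $\lambda\in\mathbb{K}$ is such that $|\lambda|=0$, then $\lambda=0$; (ii) $|\lambda\mu|=|\lambda||\mu|$ for all $\lambda,\mu\in\mathbb{K}$; (iii) $|\lambda+\mu|\leq\max\{|\lambda|,|\mu|\}$ for all $\lambda,\mu\in\mathbb{K}$. Here $|n|$ denotes the valuation of $n$ regarded as the element $n\cdot 1_{\mathbb{K}}$ of $\mathbb{K}$. $AM$ denotes the arithmetic mean: $AM(c_j)_{j=1}^n:=\frac{\sum_{j=1}^n c_j}{n}$.
   Formalization: The first and third inequalities are stated for |n| ≠ 0 only, since 1/|n| and AM are undefined when n is zero in K (positive characteristic dividing n); for n = 1 the maximum over the empty set of pairs is read as 0. *)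

theory Defs
  imports Complex_Main
begin

text \<open>
  The first axiom is only the implication from \<open>v x = 0\<close> to \<open>x = 0\<close>, so the constant
  function 1 is a (degenerate) instance; every other instance satisfies \<open>v 0 = 0\<close>.
\<close>

locale nonarch_valuation =
  fixes v :: "'a::field \<Rightarrow> real"
  assumes nonneg: "0 \<le> v x"
    and eq_zeroD: "v x = 0 \<Longrightarrow> x = 0"
    and mult: "v (x * y) = v x * v y"
    and ultrametric: "v (x + y) \<le> max (v x) (v y)"

definition AM :: "nat \<Rightarrow> (nat \<Rightarrow> 'a::field) \<Rightarrow> 'a" where
  "AM n c = (\<Sum>j=1..n. c j) / of_nat n"

text \<open>
  The inserted 0 only matters for \<open>n \<le> 1\<close>, where there are no pairs and the maximum of
  the empty family of nonnegative reals is read as 0.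
\<close>

definition max_diff_prod ::
    "('a::field \<Rightarrow> real) \<Rightarrow> nat \<Rightarrow> (nat \<Rightarrow> 'a) \<Rightarrow> (nat \<Rightarrow> 'a) \<Rightarrow> real" where
  "max_diff_prod v n a b =
     Max (insert 0 {v (a j - a k) * v (b j - b k) | j k. 1 \<le> j \<and> j < k \<and> k \<le> n})"

end

theory Submission
  imports Defs
begin

text \<open>
  Everything rests on Chebyshev's identity
  \<open>n * (\<Sum>j. a j * b j) = (\<Sum>j. a j) * (\<Sum>k. b k) + (\<Sum>j<k. (a j - a k) * (b j - b k))\<close>,
  valid in every commutative ring. Each term of the last sum has valuation at most the maximum
  over the pairs, so the ultrametric inequality bounds the whole sum by that maximum, with no
  factor counting the pairs. Reading the identity as a formula for \<open>n * (\<Sum>j. a j * b j)\<close>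
  gives the first inequality, reading it as a formula for the product of the two sums gives the
  second, and dividing the first by \<open>\<bar>n\<bar>\<close> gives the third.

  An empty sum can be bounded in this way only if \<open>v 0 = 0\<close>. This fails for the constant
  valuation 1 alone, for which all three inequalities are immediate.
\<close>

text \<open>
  Summing over all ordered pairs would give twice the identity, which is worthless in
  characteristic 2. Induction on \<open>n\<close> keeps to the pairs with \<open>j < k\<close>: the new index contributes
  \<open>\<Sum>j\<le>n. (a j - a (n+1)) * (b j - b (n+1))\<close>, which expands into the required mixed terms.
\<close>

lemma chebyshev_sum_identity:
  fixes a b :: "nat \<Rightarrow> 'a::comm_ring_1"
  shows "of_nat n * (\<Sum>j=1..n. a j * b j) =
    (\<Sum>j=1..n. a j) * (\<Sum>k=1..n. b k) + (\<Sum>k=1..n. \<Sum>j=1..<k. (a j - a k) * (b j - b k))"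
proof (induction n)
  case 0
  show ?case by simp
next
  case (Suc n)
  have expand: "(\<Sum>j=1..n. (a j - x) * (b j - y)) =
      (\<Sum>j=1..n. a j * b j) - y * (\<Sum>j=1..n. a j) - x * (\<Sum>j=1..n. b j) + of_nat n * (x * y)"
    for x y
    by (simp add: left_diff_distrib right_diff_distrib sum_subtractf sum.distrib
        sum_distrib_left mult.commute)
  have "{1..<Suc n} = {1..n}" by auto
  then have "(\<Sum>k=1..Suc n. \<Sum>j=1..<k. (a j - a k) * (b j - b k)) =
      (\<Sum>k=1..n. \<Sum>j=1..<k. (a j - a k) * (b j - b k)) +
      (\<Sum>j=1..n. (a j - a (Suc n)) * (b j - b (Suc n)))"
    by simp
  also have "(\<Sum>k=1..n. \<Sum>j=1..<k. (a j - a k) * (b j - b k)) =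
      of_nat n * (\<Sum>j=1..n. a j * b j) - (\<Sum>j=1..n. a j) * (\<Sum>k=1..n. b k)"
    using Suc.IH by simp
  finally show ?case
    by (simp only: expand) (simp add: distrib_left distrib_right mult.commute)
qed

context nonarch_valuation
begin

lemma valuation_zero_cases: "v 0 = 0 \<or> (\<forall>x. v x = 1)"
  using mult[of 0] by (metis mult_cancel_left1 mult_zero_left)

lemma valuation_one: "v 1 = 1"
  using mult[of 1 1] eq_zeroD[of 1] by auto

lemma valuation_minus: "v (- x) = v x"
proof -
  have "v (- 1) * v (- 1) = 1"
    using mult[of "- 1" "- 1"] valuation_one by simp
  then have "v (- 1) = 1"
    using nonneg[of "- 1"] by (metis abs_of_nonneg abs_1 real_sqrt_abs2 real_sqrt_one)
  then show ?thesis
    using mult[of "- 1" x] by simp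
qed

lemma valuation_diff: "v (x - y) \<le> max (v x) (v y)"
  using ultrametric[of x "- y"] by (simp add: valuation_minus)

lemma valuation_divide:
  assumes "y \<noteq> 0"
  shows "v (x / y) = v x / v y"
proof -
  have "v y \<noteq> 0" using assms eq_zeroD by blast
  moreover have "v (x / y) * v y = v x" using assms by (simp flip: mult)
  ultimately show ?thesis by (simp add: field_simps)
qed

lemma valuation_sum_le:
  assumes "v 0 \<le> M" and "\<And>i. i \<in> A \<Longrightarrow> v (f i) \<le> M"
  shows "v (sum f A) \<le> M"
  using assms(2)
proof (induction A rule: infinite_finite_induct)
  case (insert i A)
  then show ?case using ultrametric[of "f i" "sum f A"] by (force simp: max_def split: if_splits)
qed (use assms(1) in auto)

end

lemma finite_diff_prods:
  "finite {v (a j - a k) * v (b j - b k) | j k. 1 \<le> j \<and> j < k \<and> k \<le> (n::nat)}"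
  by (rule finite_subset[of _ "(\<lambda>(j, k). v (a j - a k) * v (b j - b k)) ` ({..n} \<times> {..n})"])
     auto

lemma max_diff_prod_nonneg: "0 \<le> max_diff_prod v n a b"
  unfolding max_diff_prod_def by (rule Max_ge) (simp_all add: finite_diff_prods del: One_nat_def)

lemma max_diff_prod_upper:
  assumes "1 \<le> j" "j < k" "k \<le> n"
  shows "v (a j - a k) * v (b j - b k) \<le> max_diff_prod v n a b"
  unfolding max_diff_prod_def by (rule Max_ge)
    (use assms finite_diff_prods in \<open>blast+\<close>)

theorem corollary2p11:
  fixes v :: "'a::field \<Rightarrow> real" and n :: nat and a b :: "nat \<Rightarrow> 'a"
  assumes "nonarch_valuation v"
    and "n \<ge> 1"
  shows "(v (of_nat n) \<noteq> 0 \<longrightarrow>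
            v (\<Sum>j=1..n. a j * b j)
              \<le> 1 / v (of_nat n) *
                 max (v (\<Sum>j=1..n. a j) * v (\<Sum>k=1..n. b k)) (max_diff_prod v n a b))
       \<and> v (\<Sum>j=1..n. a j) * v (\<Sum>k=1..n. b k)
            \<le> max (v (of_nat n) * v (\<Sum>j=1..n. a j * b j)) (max_diff_prod v n a b)
       \<and> (v (of_nat n) \<noteq> 0 \<longrightarrow>
            v (AM n (\<lambda>j. a j * b j))
              \<le> max (v (AM n a) * v (AM n b))
                     (1 / (v (of_nat n))\<^sup>2 * max_diff_prod v n a b))"
proof -
  interpret nonarch_valuation v by fact
  show ?thesis
  proof (cases "\<forall>x. v x = 1")
    case True
    then show ?thesis by simp
  next
    case False
    then have v0: "v 0 = 0" using valuation_zero_cases by blast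
    define N where "N = v (of_nat n)"
    define A where "A = (\<Sum>j=1..n. a j)"
    define B where "B = (\<Sum>k=1..n. b k)"
    define S where "S = (\<Sum>j=1..n. a j * b j)"
    define D where "D = (\<Sum>k=1..n. \<Sum>j=1..<k. (a j - a k) * (b j - b k))"
    define M where "M = max_diff_prod v n a b"
    have identity: "of_nat n * S = A * B + D"
      unfolding S_def A_def B_def D_def by (rule chebyshev_sum_identity)
    have "v D \<le> M"
      unfolding D_def M_def
      by (intro valuation_sum_le)
         (auto simp: v0 mult max_diff_prod_nonneg intro: max_diff_prod_upper)
    have "N * v S = v (A * B + D)"
      unfolding N_def by (simp add: identity flip: mult)
    also have "\<dots> \<le> max (v A * v B) M"
      using ultrametric[of "A * B" D] \<open>v D \<le> M\<close> by (auto simp: mult)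
    finally have S_bound: "N * v S \<le> max (v A * v B) M" .
    have "v A * v B = v (of_nat n * S - D)"
      by (simp add: identity flip: mult)
    also have "\<dots> \<le> max (N * v S) M"
      using valuation_diff[of "of_nat n * S" D] \<open>v D \<le> M\<close> by (auto simp: mult N_def)
    finally have AB_bound: "v A * v B \<le> max (N * v S) M" .
    have first: "v S \<le> 1 / N * max (v A * v B) M" if "N \<noteq> 0"
    proof -
      have "0 < N" using that nonneg[of "of_nat n"] by (simp add: N_def)
      then show ?thesis using S_bound by (simp add: pos_le_divide_eq mult.commute)
    qed
    have third: "v (AM n (\<lambda>j. a j * b j)) \<le> max (v (AM n a) * v (AM n b)) (1 / N\<^sup>2 * M)"
      if "N \<noteq> 0"
    proof -
      have "(of_nat n :: 'a) \<noteq> 0" using that v0 by (auto simp: N_def)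
      then have AM: "v (AM n c) = v (\<Sum>j=1..n. c j) / N" for c
        unfolding AM_def N_def by (rule valuation_divide)
      have "0 < N" using that nonneg[of "of_nat n"] by (simp add: N_def)
      then have "v S / N \<le> (1 / N * max (v A * v B) M) / N"
        using first by (intro divide_right_mono) auto
      also have "\<dots> = max (v A * v B) M / N\<^sup>2"
        by (simp add: power2_eq_square)
      also have "\<dots> = max (v A * v B / N\<^sup>2) (M / N\<^sup>2)"
        using \<open>0 < N\<close> by (auto simp: max_def divide_le_cancel)
      also have "v A * v B / N\<^sup>2 = (v A / N) * (v B / N)"
        by (simp add: power2_eq_square)
      finally show ?thesis
        by (simp add: AM S_def A_def B_def)
    qed
    show ?thesis
      using first AB_bound third unfolding N_def A_def B_def S_def M_def by blast
  qed
qed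

end
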